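(* Approximating Basic-Summing (with window size $W$ and integer elements in $\{0,1,\dots,R\}$) to within an additive error of $RW\epsilon$ by a deterministic algorithm requires $\Omega\left(\frac1\epsilon+\log W\right)$ bits of memory for $\frac{1}{2W}\le\epsilon\le\frac14$, and $\Omega\left(W\log\frac{1}{W\epsilon}\right)$ bits of memory for $\epsilon\le\frac{1}{2W}$.
   Context: All logarithms are base 2; $W,R\ge1$ are integers and $\epsilon>0$ is real; asymptotics are for $W\to\infty$, with hidden constants independent of $\epsilon$ and $R$. Basic-Summing: given a stream of integers in $\{0,1,\dots,R\}$ arriving one at a time, maintain the sum $S$ of the last $W$ elements (if fewer than $W$ elements have arrived, of all elements so far). A deterministic algorithm using $m$ bits of memory has at most $2^m$ memory configurations, a fixed initial configuration, and a deterministic transition of configuration upon each arriving element; when queried it outputs a real number $\widehat S$ determined by its current configuration. It approximates Basic-Summing to within an additive error of $RW\epsilon$ if $|\widehat S-S|\le RW\epsilon$ for every input stream and at every time.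
   Formalization: The second bound is stated for 1/(2RW) ≤ ε ≤ 1/(2W), not all ε ≤ 1/(2W): for R = 1, storing the window uses W bits and is exact for every ε > 0, while W log(1/(Wε)) is unbounded as ε tends to 0. *)

theory Defs
  imports Complex_Main
begin

definition window_sum :: "nat \<Rightarrow> nat list \<Rightarrow> nat" where
  \<comment> \<open>The most recent element is the last one of the list. The truncated subtraction makes
      this the sum of the whole list as long as fewer than \<open>W\<close> elements have arrived.\<close>
  "window_sum W xs = sum_list (drop (length xs - W) xs)"

record algorithm =
  initial :: "bool list"
  transition :: "bool list \<Rightarrow> nat \<Rightarrow> bool list"
  estimate :: "bool list \<Rightarrow> real"

definition uses_bits :: "nat \<Rightarrow> nat \<Rightarrow> algorithm \<Rightarrow> bool" where
  \<comment> \<open>The configurations are the bit strings of length \<open>m\<close>. They need not all be reachable, so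
      this covers every algorithm with at most \<open>2 ^ m\<close> configurations.\<close>
  "uses_bits R m A \<longleftrightarrow>
     length (initial A) = m \<and>
     (\<forall>q x. length q = m \<longrightarrow> x \<le> R \<longrightarrow> length (transition A q x) = m)"

definition configuration_after :: "algorithm \<Rightarrow> nat list \<Rightarrow> bool list" where
  "configuration_after A xs = foldl (transition A) (initial A) xs"

definition approximates_basic_summing :: "nat \<Rightarrow> nat \<Rightarrow> real \<Rightarrow> algorithm \<Rightarrow> bool" where
  \<comment> \<open>The finite lists \<open>xs\<close> are the prefixes of the input streams: one for every stream and time.
      If \<open>e < 1/2\<close>, rounding the estimates gives the exact sums, and conversely exact sums
      are maintained by any algorithm that stores the window. A memory lower bound that
      tends to infinity as \<open>e\<close> tends to 0 can therefore hold only with \<open>e\<close> bounded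
      from below.\<close>
  "approximates_basic_summing W R e A \<longleftrightarrow>
     (\<forall>xs. set xs \<subseteq> {0..R} \<longrightarrow>
        \<bar>estimate A (configuration_after A xs) - real (window_sum W xs)\<bar> \<le> e)"

end

theory Submission
  imports Defs
begin

text \<open>Two histories leading to the same configuration stay indistinguishable under every common
  continuation, so their window sums never differ by more than twice the error. Cut the window
  into blocks whose possible sums are pairwise further apart than that: padding with zeros until
  the most recent differing block is the oldest one in the window shows that all sequences of
  blocks need different configurations. Blocks of \<open>\<lfloor>2W\<epsilon>\<rfloor> + 1\<close> equal elements, \<open>0\<close> or \<open>R\<close>, give
  \<open>\<Omega>(1/\<epsilon>)\<close>; blocks of two elements with sums in a grid of mesh \<open>\<lfloor>2RW\<epsilon>\<rfloor> + 1\<close> give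
  \<open>\<Omega>(W log (1/(W\<epsilon>)))\<close>. For \<open>\<Omega>(log W)\<close>, feed the constant stream \<open>R\<close>: a repeated configuration
  before time \<open>W/2\<close> would recur forever, although the sum grows to \<open>RW\<close>.\<close>

section \<open>Configurations and indistinguishable histories\<close>

lemma configuration_after_append:
  "configuration_after A (xs @ ys) = foldl (transition A) (configuration_after A xs) ys"
  by (simp add: configuration_after_def)

lemma length_configuration_after:
  assumes "uses_bits R m A" "set xs \<subseteq> {0..R}"
  shows "length (configuration_after A xs) = m"
  using assms(2)
proof (induction xs rule: rev_induct)
  case Nil
  then show ?case
    using assms(1) by (simp add: configuration_after_def uses_bits_def)
next
  case (snoc x xs)
  then show ?case
    using assms(1) by (simp add: configuration_after_def uses_bits_def)
qed

lemma card_le_if_inj_on_configuration: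
  assumes bits: "uses_bits R m A"
    and streams: "\<And>i. i \<in> I \<Longrightarrow> set (f i) \<subseteq> {0..R}"
    and inj: "inj_on (\<lambda>i. configuration_after A (f i)) I"
  shows "card I \<le> 2 ^ m"
proof -
  let ?Q = "{q :: bool list. set q \<subseteq> UNIV \<and> length q = m}"
  have "(\<lambda>i. configuration_after A (f i)) ` I \<subseteq> ?Q"
    using length_configuration_after[OF bits streams] by auto
  moreover have "finite ?Q"
    by (rule finite_lists_length_eq) simp
  moreover have "card ?Q = 2 ^ m"
    by (subst card_lists_length_eq) (simp_all add: card_UNIV_bool)
  ultimately show ?thesis
    using card_inj_on_le[OF inj] by metis
qed

lemma window_sum_diff_le:
  assumes approx: "approximates_basic_summing W R e A"
    and same: "configuration_after A xs = configuration_after A ys"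
    and streams: "set xs \<subseteq> {0..R}" "set ys \<subseteq> {0..R}" "set zs \<subseteq> {0..R}"
  shows "\<bar>real (window_sum W (xs @ zs)) - real (window_sum W (ys @ zs))\<bar> \<le> 2 * e"
proof -
  have "configuration_after A (xs @ zs) = configuration_after A (ys @ zs)"
    by (simp add: configuration_after_append same)
  moreover have "\<bar>estimate A (configuration_after A (xs @ zs)) - real (window_sum W (xs @ zs))\<bar> \<le> e"
    and "\<bar>estimate A (configuration_after A (ys @ zs)) - real (window_sum W (ys @ zs))\<bar> \<le> e"
    using approx streams unfolding approximates_basic_summing_def by simp_all
  ultimately show ?thesis
    by simp
qed

section \<open>Counting sequences of separated blocks\<close>

lemma window_sum_append_length_eq:
  "length ys = W \<Longrightarrow> window_sum W (xs @ ys) = sum_list ys"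
  by (simp add: window_sum_def)

lemma length_concat_map_const:
  "(\<And>i. i \<in> set is \<Longrightarrow> length (f i) = L) \<Longrightarrow> length (concat (map f is)) = length is * L"
  by (induction "is") auto

text \<open>The index set is abstract so that one argument serves both kinds of blocks: each of the
  \<open>W div L\<close> blocks that fit into the window costs \<open>log 2 (card I)\<close>
  bits.\<close>

lemma card_power_div_le:
  assumes bits: "uses_bits R m A"
    and approx: "approximates_basic_summing W R e A"
    and I: "finite I"
    and len: "\<And>i. i \<in> I \<Longrightarrow> length (block i) = L"
    and streams: "\<And>i. i \<in> I \<Longrightarrow> set (block i) \<subseteq> {0..R}"
    and separated: "\<And>i j. i \<in> I \<Longrightarrow> j \<in> I \<Longrightarrow> i \<noteq> j \<Longrightarrow>
      2 * e < \<bar>real (sum_list (block i)) - real (sum_list (block j))\<bar>"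
  shows "card I ^ (W div L) \<le> 2 ^ m"
proof -
  \<comment> \<open>The list is reversed so that its head is the most recent block. The common
    prefix \<open>ps\<close> found below is then the part that arrives after the last differing
    block.\<close>
  define stream where "stream is = concat (map block (rev is))" for "is"
  let ?J = "{is. set is \<subseteq> I \<and> length is = W div L}"
  have stream: "set (stream is) \<subseteq> {0..R}" if "set is \<subseteq> I" for "is"
    using that streams unfolding stream_def by fastforce
  have "inj_on (\<lambda>is. configuration_after A (stream is)) ?J"
  proof (rule inj_onI, rule ccontr)
    fix xs ys
    assume xs: "xs \<in> ?J" and ys: "ys \<in> ?J" and "xs \<noteq> ys"
      and same: "configuration_after A (stream xs) = configuration_after A (stream ys)"
    have "length xs = length ys"
      using xs ys by simp
    then obtain ps x xs' y ys' where ne: "x \<noteq> y"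
      and xs_eq: "xs = ps @ [x] @ xs'" and ys_eq: "ys = ps @ [y] @ ys'"
      using same_length_different[OF \<open>xs \<noteq> ys\<close>] by blast
    \<comment> \<open>With these zeros appended, the differing block, the blocks of
      \<open>ps\<close> and the padding fill the window exactly. All older blocks have left it, and
      \<open>ps\<close> contributes equally to both sums, so only the difference of the two block
      sums remains.\<close>
    define zs where "zs = replicate (W - Suc (length ps) * L) (0::nat)"
    have "Suc (length ps) \<le> W div L"
      using xs by (auto simp: xs_eq)
    then have fits: "Suc (length ps) * L \<le> W"
      by (metis div_times_less_eq_dividend le_trans mult_le_mono1)
    have sum: "window_sum W (stream (ps @ [i] @ is) @ zs)
        = sum_list (block i) + sum_list (stream ps)"
      if "set (ps @ [i] @ is) \<subseteq> I" for i "is"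
    proof -
      have "length (stream ps) = length ps * L"
        unfolding stream_def using len that by (subst length_concat_map_const) auto
      then have "length (block i @ stream ps @ zs) = W"
        using fits len[of i] that by (simp add: zs_def)
      then have "window_sum W (stream is @ block i @ stream ps @ zs)
          = sum_list (block i @ stream ps @ zs)"
        by (rule window_sum_append_length_eq)
      then show ?thesis
        by (simp add: stream_def zs_def)
    qed
    have "\<bar>real (window_sum W (stream xs @ zs)) - real (window_sum W (stream ys @ zs))\<bar> \<le> 2 * e"
      using xs ys by (intro window_sum_diff_le[OF approx same] stream) (auto simp: zs_def)
    then have "\<bar>real (sum_list (block x)) - real (sum_list (block y))\<bar> \<le> 2 * e"
      using sum[of x xs'] sum[of y ys'] xs ys by (simp add: xs_eq ys_eq)
    moreover have "x \<in> I" "y \<in> I"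
      using xs ys by (auto simp: xs_eq ys_eq)
    ultimately show False
      using separated[of x y] ne by force
  qed
  then have "card ?J \<le> 2 ^ m"
    using stream by (intro card_le_if_inj_on_configuration[OF bits]) auto
  then show ?thesis
    by (simp add: card_lists_length_eq[OF I])
qed

section \<open>The constant stream\<close>

lemma funpow_recurrent:
  fixes f :: "'a \<Rightarrow> 'a"
  assumes "(f ^^ i) x = (f ^^ j) x" "i < j"
  shows "\<exists>n\<ge>N. (f ^^ n) x = (f ^^ i) x"
proof -
  \<comment> \<open>The orbit is periodic from \<open>i\<close> on with period
    \<open>j - i > 0\<close>, so \<open>N\<close> turns lead past time \<open>N\<close>.\<close>
  have "(f ^^ (i + k * (j - i))) x = (f ^^ i) x" for k
  proof (induction k)
    case (Suc k)
    have "(f ^^ (i + Suc k * (j - i))) x = (f ^^ (j - i)) ((f ^^ (i + k * (j - i))) x)"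
      by (metis add.assoc add.commute comp_apply funpow_add mult_Suc)
    also have "\<dots> = (f ^^ (j - i + i)) x"
      unfolding Suc.IH by (simp add: funpow_add)
    also have "\<dots> = (f ^^ i) x"
      using assms by simp
    finally show ?case .
  qed simp
  moreover have "N \<le> i + N * (j - i)"
    using \<open>i < j\<close> by (intro trans_le_add2) (simp add: Suc_le_eq)
  ultimately show ?thesis
    by blast
qed

lemma half_window_le_configurations:
  assumes bits: "uses_bits R m A"
    and approx: "approximates_basic_summing W R e A"
    and R: "R \<ge> 1" and e: "e \<le> real R * real W / 4"
  shows "real W \<le> 2 * 2 ^ m"
proof -
  let ?conf = "\<lambda>i. configuration_after A (replicate i R)"
  have conf: "?conf i = ((\<lambda>q. transition A q R) ^^ i) (initial A)" for i
    unfolding configuration_after_def by (induction i) (simp_all flip: replicate_append_same)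
  have sum: "window_sum W (replicate i R) = min i W * R" for i
    by (simp add: window_sum_def sum_list_replicate min_def)
  \<comment> \<open>At time \<open>i\<close> the sum is \<open>i * R\<close>, at the recurrence
    \<open>n \<ge> W\<close> it is \<open>W * R\<close>. The gap exceeds \<open>W * R / 2\<close>
    because \<open>2 * i < W\<close>, whereas \<open>e \<le> R * W / 4\<close> allows at most
    \<open>W * R / 2\<close>.\<close>
  have neq: "?conf i \<noteq> ?conf j" if "i < j" "2 * i < W" for i j
  proof
    assume "?conf i = ?conf j"
    then obtain n where n: "n \<ge> W" "?conf n = ?conf i"
      using funpow_recurrent[OF _ \<open>i < j\<close>, of "\<lambda>q. transition A q R" "initial A" W]
      unfolding conf by blast
    have "\<bar>real (window_sum W (replicate n R @ [])) - real (window_sum W (replicate i R @ []))\<bar>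
        \<le> 2 * e"
      using n(2) by (intro window_sum_diff_le[OF approx]) auto
    moreover have "min n W = W" "min i W = i"
      using n(1) that by simp_all
    ultimately have "real W * real R - real i * real R \<le> 2 * e"
      by (simp add: sum)
    then have "(real W - 2 * real i) * real R \<le> 0"
      using e by (simp add: algebra_simps)
    moreover have "(real W - 2 * real i) * real R > 0"
      using that R by simp
    ultimately show False
      by simp
  qed
  have "inj_on ?conf {i. 2 * i < W}"
    by (rule inj_onI) (metis (mono_tags, lifting) linorder_neqE_nat mem_Collect_eq neq)
  then have "card {i. 2 * i < W} \<le> 2 ^ m"
    by (rule card_le_if_inj_on_configuration[OF bits, rotated]) auto
  moreover have "{i. 2 * i < W} = {..<(W + 1) div 2}"
    by auto
  ultimately have "(W + 1) div 2 \<le> 2 ^ m"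
    by simp
  then have "W \<le> 2 * 2 ^ m"
    by linarith
  then have "real W \<le> real (2 * 2 ^ m)"
    by (rule of_nat_mono)
  then show ?thesis
    by simp
qed

section \<open>Choice of the blocks in the two ranges of \<epsilon>\<close>

lemma real_div_ge_half:
  fixes a b :: nat
  assumes "0 < b" "b \<le> a"
  shows "real (a div b) \<ge> real a / real b / 2"
proof -
  have "1 \<le> a div b"
    using assms by (simp add: Suc_le_eq div_greater_zero_iff)
  then have "b \<le> (a div b) * b"
    by (metis mult_1 mult_le_mono1)
  moreover have "a mod b < b" "a = (a div b) * b + a mod b"
    using assms by simp_all
  ultimately have "a \<le> 2 * (a div b) * b"
    by linarith
  then have "real a \<le> real (2 * (a div b) * b)"
    by (rule of_nat_mono)
  then show ?thesis
    using assms by (simp add: field_simps)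
qed

lemma inverse_error_le_bits:
  assumes bits: "uses_bits R m A"
    and approx: "approximates_basic_summing W R (real R * real W * \<epsilon>) A"
    and R: "R \<ge> 1" and W: "W \<ge> 2" and \<epsilon>: "1 / (2 * real W) \<le> \<epsilon>" "\<epsilon> \<le> 1 / 4"
  shows "1 / \<epsilon> \<le> 8 * real m"
proof -
  \<comment> \<open>The least length for which the block sums \<open>0\<close> and
    \<open>R * L\<close> are further apart than twice the error.\<close>
  define L where "L = nat \<lfloor>2 * real W * \<epsilon>\<rfloor> + 1"
  have We: "1 \<le> 2 * real W * \<epsilon>"
    using \<epsilon>(1) W by (simp add: field_simps)
  then have L: "2 * real W * \<epsilon> < real L" "real L \<le> 2 * real W * \<epsilon> + 1"
    unfolding L_def by linarith+
  have "0 < 1 / (2 * real W)"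
    using W by simp
  then have "\<epsilon> > 0"
    using \<epsilon>(1) by linarith
  \<comment> \<open>Hence \<open>L \<le> W / 2 + 1 \<le> W\<close>, as \<open>W \<ge> 2\<close>: at
    least one whole block fits.\<close>
  have "real W * \<epsilon> \<le> real W * (1 / 4)"
    using \<epsilon>(2) by (intro mult_left_mono) auto
  then have "L \<le> W"
    using L(2) W by linarith
  have "L > 0"
    by (simp add: L_def)
  have "card (UNIV :: bool set) ^ (W div L) \<le> 2 ^ m"
  proof (rule card_power_div_le[OF bits approx])
    show "2 * (real R * real W * \<epsilon>) <
        \<bar>real (sum_list (replicate L (if i then R else 0))) -
          real (sum_list (replicate L (if j then R else 0)))\<bar>" if "i \<noteq> j" for i j
    proof -
      have "real R * (2 * real W * \<epsilon>) < real R * real L"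
        using L(1) R by (intro mult_strict_left_mono) auto
      then show ?thesis
        using that by (auto simp: sum_list_replicate algebra_simps)
    qed
  qed auto
  then have "W div L \<le> m"
    by (simp add: card_UNIV_bool)
  \<comment> \<open>Since \<open>1 \<le> 2 * W * \<epsilon>\<close>, the rounding in
    \<open>L\<close> at most doubles it, to \<open>4 * W * \<epsilon>\<close>; rounding
    \<open>W / L\<close> down costs another factor 2.\<close>
  have "1 / (8 * \<epsilon>) = real W / (4 * real W * \<epsilon>) / 2"
    using W by simp
  also have "\<dots> \<le> real W / real L / 2"
    using L We \<open>L > 0\<close> \<open>\<epsilon> > 0\<close> W by (intro divide_right_mono divide_left_mono) auto
  also have "\<dots> \<le> real (W div L)"
    using real_div_ge_half[OF \<open>L > 0\<close> \<open>L \<le> W\<close>] .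
  also have "\<dots> \<le> real m"
    using \<open>W div L \<le> m\<close> by simp
  finally show ?thesis
    using \<open>\<epsilon> > 0\<close> by (simp add: field_simps)
qed

text \<open>The lower bound on \<epsilon> makes twice the error at least 1, so rounding it up to an
  integer mesh at most doubles it. Blocks have two elements because single ones can fail: if twice
  the error equals \<open>R\<close>, the mesh is \<open>R + 1\<close> and \<open>{0..R}\<close>
  contains only one grid point.\<close>

lemma log_inverse_error_le_bits:
  assumes bits: "uses_bits R m A"
    and approx: "approximates_basic_summing W R (real R * real W * \<epsilon>) A"
    and R: "R \<ge> 1" and W: "W \<ge> 2"
    and \<epsilon>: "1 / (2 * real R * real W) \<le> \<epsilon>" "\<epsilon> \<le> 1 / (2 * real W)"
  shows "real W * log 2 (1 / (real W * \<epsilon>)) \<le> 8 * real m"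
proof -
  define E where "E = real R * real W * \<epsilon>"
  define D where "D = nat \<lfloor>2 * E\<rfloor> + 1"
  \<comment> \<open>The number of multiples of \<open>D\<close> in \<open>{0..2 * R}\<close>, the
    range of sums of two elements.\<close>
  define K where "K = 2 * R div D + 1"
  have E: "1 \<le> 2 * E" "2 * E \<le> real R"
    using \<epsilon> R W by (simp_all add: E_def field_simps)
  have D: "2 * E < real D" "real D \<le> 4 * E" "D > 0"
    using E(1) unfolding D_def by linarith+
  have "card {..<K} ^ (W div 2) \<le> 2 ^ m"
  proof (rule card_power_div_le[OF bits approx])
    \<comment> \<open>The sum \<open>k * D \<le> 2 * R\<close> is split as evenly as possible, which
      keeps both entries at most \<open>R\<close>.\<close>
    let ?block = "\<lambda>k. [k * D div 2, k * D - k * D div 2]"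
    show "set (?block k) \<subseteq> {0..R}" if "k \<in> {..<K}" for k
    proof -
      have "k * D \<le> (2 * R div D) * D"
        using that by (simp add: K_def)
      also have "\<dots> \<le> 2 * R"
        by (rule div_times_less_eq_dividend)
      finally show ?thesis
        by auto
    qed
    show "2 * (real R * real W * \<epsilon>) < \<bar>real (sum_list (?block j)) - real (sum_list (?block k))\<bar>"
      if "j \<noteq> k" for j k
    proof -
      have "1 \<le> \<bar>real j - real k\<bar>"
        using that by linarith
      then have "1 * real D \<le> \<bar>real j - real k\<bar> * real D"
        by (rule mult_right_mono) simp
      also have "\<dots> = \<bar>real (j * D) - real (k * D)\<bar>"
        by (simp add: abs_mult flip: left_diff_distrib)
      finally show ?thesis
        using D(1) by (simp add: E_def)
    qed
  qed auto
  then have "K ^ (W div 2) \<le> 2 ^ m"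
    by simp
  then have "real (K ^ (W div 2)) \<le> real (2 ^ m)"
    by (rule of_nat_mono)
  then have "log 2 (real K ^ (W div 2)) \<le> log 2 (2 ^ m)"
    by (subst log_le_cancel_iff) (simp_all add: K_def)
  then have bits_ge: "real (W div 2) * log 2 (real K) \<le> real m"
    by (simp add: log_nat_power K_def)
  \<comment> \<open>This is \<open>1 / (2 * W * \<epsilon>)\<close>, half the argument of the target
    logarithm. From \<open>D \<le> 4 * E\<close> follows \<open>x \<le> 2 * R / D < K\<close>; with
    \<open>2 \<le> K\<close> the factor 2 is absorbed by \<open>2 * x \<le> K ^ 2\<close>.\<close>
  define x where "x = real R / (2 * E)"
  have "2 * real R / real D < real K"
  proof -
    have "2 * R < K * D"
      using D(3) unfolding K_def by (simp add: dividend_less_div_times)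
    then have "real (2 * R) < real (K * D)"
      by (simp only: of_nat_less_iff)
    then show ?thesis
      using D(3) by (simp add: field_simps)
  qed
  moreover have "x \<le> 2 * real R / real D"
  proof -
    have "2 * real R / (4 * E) \<le> 2 * real R / real D"
      using D E by (intro divide_left_mono) auto
    then show ?thesis
      by (simp add: x_def)
  qed
  ultimately have x: "x \<le> real K" "1 \<le> x"
    using E by (simp_all add: x_def)
  have "2 \<le> K"
  proof -
    have "real D \<le> 2 * real R"
      using D E by linarith
    then have "0 < 2 * R div D"
      using D(3) by (simp add: div_greater_zero_iff)
    then show ?thesis
      by (simp add: K_def)
  qed
  have "1 / (real W * \<epsilon>) = 2 * x"
    using R by (simp add: x_def E_def)
  moreover have "2 * x \<le> real K * real K"
    using x \<open>2 \<le> K\<close> by (intro mult_mono) auto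
  ultimately have "log 2 (1 / (real W * \<epsilon>)) \<le> log 2 (real K ^ 2)"
    using x by (simp add: power2_eq_square)
  also have "\<dots> = 2 * log 2 (real K)"
    using \<open>2 \<le> K\<close> by (simp add: log_nat_power)
  finally have "real W * log 2 (1 / (real W * \<epsilon>)) \<le> real W * (2 * log 2 (real K))"
    by (rule mult_left_mono) simp
  \<comment> \<open>The 8 combines the 2 from squaring \<open>K\<close> with the 4 from
    \<open>W div 2 \<ge> W / 4\<close>.\<close>
  also have "\<dots> = 8 * (real W / real 2 / 2 * log 2 (real K))"
    by simp
  also have "\<dots> \<le> 8 * (real (W div 2) * log 2 (real K))"
    using real_div_ge_half[of 2 W] W \<open>2 \<le> K\<close> by (intro mult_left_mono mult_right_mono) auto
  also have "\<dots> \<le> 8 * real m"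
    using bits_ge by simp
  finally show ?thesis .
qed

section \<open>Assembly of the two bounds\<close>

theorem theorem13:
  shows "(\<exists>c::real. c > 0 \<and>
      (\<forall>\<^sub>F W::nat in sequentially. \<forall>(R::nat) (\<epsilon>::real) (m::nat) (A::algorithm).
         R \<ge> 1 \<longrightarrow> 1 / (2 * real W) \<le> \<epsilon> \<longrightarrow> \<epsilon> \<le> 1 / 4 \<longrightarrow>
         uses_bits R m A \<longrightarrow> approximates_basic_summing W R (real R * real W * \<epsilon>) A \<longrightarrow>
         real m \<ge> c * (1 / \<epsilon> + log 2 (real W))))
    \<and> (\<exists>c::real. c > 0 \<and>
      (\<forall>\<^sub>F W::nat in sequentially. \<forall>(R::nat) (\<epsilon>::real) (m::nat) (A::algorithm).
         R \<ge> 1 \<longrightarrow> 1 / (2 * real R * real W) \<le> \<epsilon> \<longrightarrow> \<epsilon> \<le> 1 / (2 * real W) \<longrightarrow>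
         uses_bits R m A \<longrightarrow> approximates_basic_summing W R (real R * real W * \<epsilon>) A \<longrightarrow>
         real m \<ge> c * (real W * log 2 (1 / (real W * \<epsilon>)))))"
proof (intro conjI)
  have "real m \<ge> 1 / 16 * (1 / \<epsilon> + log 2 (real W))"
    if W: "W \<ge> 2" and R: "R \<ge> 1" and \<epsilon>: "1 / (2 * real W) \<le> \<epsilon>" "\<epsilon> \<le> 1 / 4"
      and A: "uses_bits R m A" "approximates_basic_summing W R (real R * real W * \<epsilon>) A"
    for W R m :: nat and \<epsilon> :: real and A
  proof -
    have "0 < 1 / (2 * real W)"
      using W by simp
    then have "\<epsilon> > 0"
      using \<epsilon>(1) by linarith
    have inverse: "1 / \<epsilon> \<le> 8 * real m"
      using inverse_error_le_bits[OF A R W \<epsilon>] .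
    \<comment> \<open>This forces \<open>m \<ge> 1\<close>, which absorbs the extra 1 in
      \<open>log 2 W \<le> m + 1\<close>. The total is then at most \<open>8 * m + 2 * m\<close>,
      within \<open>16 * m\<close>.\<close>
    moreover have "1 / \<epsilon> \<ge> 4"
      using \<epsilon>(2) \<open>\<epsilon> > 0\<close> by (simp add: field_simps)
    ultimately have "real m > 0"
      by linarith
    then have "real m \<ge> 1"
      by simp
    have "real R * real W * \<epsilon> \<le> real R * real W * (1 / 4)"
      using \<epsilon>(2) by (intro mult_left_mono) auto
    then have "real W \<le> 2 * 2 ^ m"
      using half_window_le_configurations[OF A R] by simp
    then have "log 2 (real W) \<le> log 2 (2 ^ Suc m)"
      using W by (subst log_le_cancel_iff) auto
    then have "log 2 (real W) \<le> real (Suc m)"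
      by (simp only: log_pow_cancel)
    then show ?thesis
      using inverse \<open>real m \<ge> 1\<close> by (simp add: field_simps)
  qed
  then show "\<exists>c::real. c > 0 \<and>
      (\<forall>\<^sub>F W::nat in sequentially. \<forall>(R::nat) (\<epsilon>::real) (m::nat) (A::algorithm).
         R \<ge> 1 \<longrightarrow> 1 / (2 * real W) \<le> \<epsilon> \<longrightarrow> \<epsilon> \<le> 1 / 4 \<longrightarrow>
         uses_bits R m A \<longrightarrow> approximates_basic_summing W R (real R * real W * \<epsilon>) A \<longrightarrow>
         real m \<ge> c * (1 / \<epsilon> + log 2 (real W)))"
    by (intro exI[of _ "1 / 16"] conjI eventually_sequentiallyI[of 2]) auto
next
  have "real m \<ge> 1 / 8 * (real W * log 2 (1 / (real W * \<epsilon>)))"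
    if "W \<ge> 2" "R \<ge> 1" "1 / (2 * real R * real W) \<le> \<epsilon>" "\<epsilon> \<le> 1 / (2 * real W)"
      "uses_bits R m A" "approximates_basic_summing W R (real R * real W * \<epsilon>) A"
    for W R m :: nat and \<epsilon> :: real and A
    using log_inverse_error_le_bits[OF that(5,6,2,1,3,4)] by simp
  then show "\<exists>c::real. c > 0 \<and>
      (\<forall>\<^sub>F W::nat in sequentially. \<forall>(R::nat) (\<epsilon>::real) (m::nat) (A::algorithm).
         R \<ge> 1 \<longrightarrow> 1 / (2 * real R * real W) \<le> \<epsilon> \<longrightarrow> \<epsilon> \<le> 1 / (2 * real W) \<longrightarrow>
         uses_bits R m A \<longrightarrow> approximates_basic_summing W R (real R * real W * \<epsilon>) A \<longrightarrow>
         real m \<ge> c * (real W * log 2 (1 / (real W * \<epsilon>))))"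
    by (intro exI[of _ "1 / 8"] conjI eventually_sequentiallyI[of 2]) (simp, blast)
qed

end
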